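(* For a positive integer $n$, let $\mathcal{MAC}^s(n) = \max\{|\mathcal{AC}^s(\mathbf{P})| : \mathbf{P}=(X,\leq) \text{ a poset with } |X|\leq n\}$ be the maximum number of strict alternating cycles of a poset $\mathbf{P}=(X,\leq)$ with $|X|\leq n$. Then $\mathcal{MAC}^s(n) = |\mathcal{AC}^s(\mathbf{P}_0)|$, where $\mathbf{P}_0=(X,=)$ is the trivial poset with $|X|=n$.
   Context: All posets are finite with nonempty ground set, and partial orders $\leq$ are reflexive. For a poset $\mathbf{P}=(X,\leq)$, $\mathrm{inc}(\mathbf{P})$ is the set of ordered pairs $(x,y)$ of elements of $X$ that are incomparable (neither $x\leq y$ nor $y\leq x$). An alternating cycle of $\mathbf{P}$ is a cyclically ordered tuple $S=[(x_1,y_1),\ldots,(x_k,y_k)]$ with each $(x_i,y_i)\in\mathrm{inc}(\mathbf{P})$ and $y_i\leq x_{i+1}$ for every $i$, indices modulo $k$; two such tuples of the same length $k$ are considered identical iff they differ by a cyclic shift of the index. It is strict if $y_i\leq x_j$ implies $j=i+1$ modulo $k$. $\mathcal{AC}^s(\mathbf{P})$ denotes the set of strict alternating cycles of $\mathbf{P}$. The trivial poset $(X,=)$ is the poset in which $x\leq y$ iff $x=y$. *)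

theory Defs
  imports Main
begin

text \<open>A poset is a pair of a ground set \<open>X\<close> and an order relation \<open>r\<close>, the library's
  \<^const>\<open>partial_order_on\<close> being reflexive on \<open>X\<close> and contained in \<open>X \<times> X\<close>.\<close>

definition finite_poset :: "'a set \<Rightarrow> ('a \<times> 'a) set \<Rightarrow> bool" where
  "finite_poset X r \<longleftrightarrow> finite X \<and> X \<noteq> {} \<and> partial_order_on X r"

definition inc :: "'a set \<Rightarrow> ('a \<times> 'a) set \<Rightarrow> ('a \<times> 'a) set" where
  "inc X r = {(x, y). x \<in> X \<and> y \<in> X \<and> (x, y) \<notin> r \<and> (y, x) \<notin> r}"

text \<open>The entry \<open>S ! i = (x, y)\<close> is the pair with index \<open>i + 1\<close> in the usual one-based numbering.\<close>

definition alternating_cycle :: "'a set \<Rightarrow> ('a \<times> 'a) set \<Rightarrow> ('a \<times> 'a) list \<Rightarrow> bool" where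
  "alternating_cycle X r S \<longleftrightarrow>
     S \<noteq> [] \<and> set S \<subseteq> inc X r \<and>
     (\<forall>i < length S. (snd (S ! i), fst (S ! ((i + 1) mod length S))) \<in> r)"

definition strict_alternating_cycle :: "'a set \<Rightarrow> ('a \<times> 'a) set \<Rightarrow> ('a \<times> 'a) list \<Rightarrow> bool" where
  "strict_alternating_cycle X r S \<longleftrightarrow>
     alternating_cycle X r S \<and>
     (\<forall>i < length S. \<forall>j < length S.
        (snd (S ! i), fst (S ! j)) \<in> r \<longrightarrow> j = (i + 1) mod length S)"

definition cyclic_shift_rel :: "('b list \<times> 'b list) set" where
  "cyclic_shift_rel = {(S, T). \<exists>m. T = rotate m S}"

text \<open>Cyclically ordered tuples are classes of lists modulo cyclic shifts.\<close>

definition ACs :: "'a set \<Rightarrow> ('a \<times> 'a) set \<Rightarrow> ('a \<times> 'a) list set set" where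
  "ACs X r = {S. strict_alternating_cycle X r S} // cyclic_shift_rel"

text \<open>The maximum ranges over posets whose elements are natural numbers. Up to isomorphism these
  are all finite posets; \<open>MACs_greatest\<close> and \<open>MACs_attained\<close> below show that
  the maximum exists and bounds the posets over every type.\<close>

definition MACs :: "nat \<Rightarrow> nat" where
  "MACs n = Max {card (ACs X r) | (X :: nat set) r. finite_poset X r \<and> card X \<le> n}"

lemma equiv_cyclic_shift_rel: "equiv UNIV (cyclic_shift_rel :: ('b list \<times> 'b list) set)"
proof (rule equivI)
  show "refl (cyclic_shift_rel :: ('b list \<times> 'b list) set)"
    by (auto simp: cyclic_shift_rel_def refl_on_def intro: exI[of _ 0])
  show "sym (cyclic_shift_rel :: ('b list \<times> 'b list) set)"
  proof (rule symI)
    fix S T :: "'b list"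
    assume "(S, T) \<in> cyclic_shift_rel"
    then obtain m where m: "T = rotate m S" by (auto simp: cyclic_shift_rel_def)
    have "rotate (length S - m mod length S) T = S"
    proof (cases "S = []")
      case False
      then have "m mod length S < length S" by simp
      moreover have "T = rotate (m mod length S) S" using m rotate_conv_mod by blast
      ultimately show ?thesis by (simp add: rotate_rotate)
    qed (simp add: m)
    then have "S = rotate (length S - m mod length S) T" by simp
    then show "(T, S) \<in> cyclic_shift_rel" unfolding cyclic_shift_rel_def by blast
  qed
  show "trans (cyclic_shift_rel :: ('b list \<times> 'b list) set)"
    by (auto simp: cyclic_shift_rel_def trans_def rotate_rotate)
qed auto

lemma strict_alternating_cycle_length:
  assumes "finite X" "strict_alternating_cycle X r S"
  shows "set S \<subseteq> X \<times> X" "length S \<le> card X"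
proof -
  have ac: "alternating_cycle X r S"
    and st: "\<And>i j. i < length S \<Longrightarrow> j < length S \<Longrightarrow>
        (snd (S ! i), fst (S ! j)) \<in> r \<Longrightarrow> j = (i + 1) mod length S"
    using assms(2) unfolding strict_alternating_cycle_def by auto
  show sub: "set S \<subseteq> X \<times> X" using ac unfolding alternating_cycle_def inc_def by auto
  have "distinct (map fst S)"
  proof (subst distinct_conv_nth, intro allI impI)
    fix j j'
    assume j: "j < length (map fst S)" and j': "j' < length (map fst S)" and ne: "j \<noteq> j'"
    show "map fst S ! j \<noteq> map fst S ! j'"
    proof
      assume eq: "map fst S ! j = map fst S ! j'"
      define i where "i = (j + length S - 1) mod length S"
      have "0 < length S" using j by (cases S) auto
      then have i: "i < length S" unfolding i_def by (rule mod_less_divisor)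
      have "(i + 1) mod length S = (j + length S - 1 + 1) mod length S"
        unfolding i_def by (rule mod_add_left_eq)
      also have "j + length S - 1 + 1 = j + length S" using \<open>0 < length S\<close> by simp
      also have "(j + length S) mod length S = j" using j by simp
      finally have ij: "(i + 1) mod length S = j" .
      have "(snd (S ! i), fst (S ! j)) \<in> r"
        using ac i unfolding alternating_cycle_def by (metis ij)
      then have "(snd (S ! i), fst (S ! j')) \<in> r" using eq j j' by simp
      then have "j' = j" using st[OF i] j' ij by simp
      then show False using ne by simp
    qed
  qed
  then have "length S = card (fst ` set S)" by (metis distinct_card length_map set_map)
  also have "\<dots> \<le> card X" by (rule card_mono) (use assms sub in auto)
  finally show "length S \<le> card X" .
qed

lemma ACs_conv_image: "ACs X r = (\<lambda>S. cyclic_shift_rel `` {S}) ` {S. strict_alternating_cycle X r S}"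
  unfolding ACs_def quotient_def by auto

lemma finite_strict_alternating_cycles:
  assumes "finite X"
  shows "finite {S. strict_alternating_cycle X r S}"
  by (rule finite_subset[OF _ finite_lists_length_le[of "X \<times> X" "card X"]])
     (use assms strict_alternating_cycle_length in blast)+

lemma finite_ACs: "finite X \<Longrightarrow> finite (ACs X r)"
  by (simp add: ACs_conv_image finite_strict_alternating_cycles)

lemma card_ACs_le:
  assumes "finite X" "card X \<le> n"
  shows "card (ACs X r) \<le> (\<Sum>i\<le>n. (n * n) ^ i)"
proof -
  have "card (ACs X r) \<le> card {S. strict_alternating_cycle X r S}"
    unfolding ACs_conv_image by (rule card_image_le) (rule finite_strict_alternating_cycles[OF assms(1)])
  also have "\<dots> \<le> card {S. set S \<subseteq> X \<times> X \<and> length S \<le> n}"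
  proof (rule card_mono)
    show "finite {S. set S \<subseteq> X \<times> X \<and> length S \<le> n}"
      using assms by (intro finite_lists_length_le) auto
    show "{S. strict_alternating_cycle X r S} \<subseteq> {S. set S \<subseteq> X \<times> X \<and> length S \<le> n}"
    proof
      fix S assume "S \<in> {S. strict_alternating_cycle X r S}"
      then have "strict_alternating_cycle X r S" by simp
      from strict_alternating_cycle_length[OF assms(1) this] assms(2)
      show "S \<in> {S. set S \<subseteq> X \<times> X \<and> length S \<le> n}" by simp
    qed
  qed
  also have "\<dots> = (\<Sum>i\<le>n. (card X * card X) ^ i)"
    using assms by (simp add: card_lists_length_le card_cartesian_product)
  also have "\<dots> \<le> (\<Sum>i\<le>n. (n * n) ^ i)"
    by (intro sum_mono power_mono mult_mono) (use assms in auto)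
  finally show ?thesis .
qed

lemma finite_MACs_set: "finite {card (ACs X r) | (X :: 'a set) r. finite_poset X r \<and> card X \<le> n}"
  by (rule finite_subset[of _ "{..(\<Sum>i\<le>n. (n * n) ^ i)}"])
     (auto simp: finite_poset_def intro: card_ACs_le)

lemma MACs_attained:
  assumes "n > 0"
  shows "\<exists>(X :: nat set) r. finite_poset X r \<and> card X \<le> n \<and> MACs n = card (ACs X r)"
proof -
  have "finite_poset {0::nat} (Id_on {0}) \<and> card {0::nat} \<le> n"
    using assms by (auto simp: finite_poset_def partial_order_on_def preorder_on_def
        refl_on_def trans_def antisym_def)
  then have "{card (ACs X r) | (X :: nat set) r. finite_poset X r \<and> card X \<le> n} \<noteq> {}"
    by blast
  from Max_in[OF finite_MACs_set this] show ?thesis unfolding MACs_def by blast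
qed

lemma map_prod_image_iff:
  assumes "inj_on f X" "r \<subseteq> X \<times> X" "x \<in> X" "y \<in> X"
  shows "(f x, f y) \<in> map_prod f f ` r \<longleftrightarrow> (x, y) \<in> r"
proof
  assume "(f x, f y) \<in> map_prod f f ` r"
  then obtain a b where ab: "(a, b) \<in> r" "f x = f a" "f y = f b" by auto
  then have "a \<in> X" "b \<in> X" using assms(2) by auto
  with ab assms have "x = a" "y = b" by (auto dest: inj_onD)
  with ab show "(x, y) \<in> r" by simp
next
  assume "(x, y) \<in> r"
  then have "map_prod f f (x, y) \<in> map_prod f f ` r" by (rule imageI)
  then show "(f x, f y) \<in> map_prod f f ` r" by simp
qed

lemma inc_map_prod:
  assumes "inj_on f X" "r \<subseteq> X \<times> X"
  shows "inc (f ` X) (map_prod f f ` r) = map_prod f f ` inc X r"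
proof -
  have *: "(f x, f y) \<in> map_prod f f ` r \<longleftrightarrow> (x, y) \<in> r" if "x \<in> X" "y \<in> X" for x y
    using assms that by (rule map_prod_image_iff)
  show ?thesis
  proof (intro equalityI subsetI)
    fix p assume "p \<in> inc (f ` X) (map_prod f f ` r)"
    then obtain x y where p: "p = (f x, f y)" and xy: "x \<in> X" "y \<in> X"
      and "(f x, f y) \<notin> map_prod f f ` r" "(f y, f x) \<notin> map_prod f f ` r"
      unfolding inc_def by blast
    then have "(x, y) \<in> inc X r" by (simp add: inc_def *)
    then have "map_prod f f (x, y) \<in> map_prod f f ` inc X r" by (rule imageI)
    then show "p \<in> map_prod f f ` inc X r" using p by simp
  next
    fix p assume "p \<in> map_prod f f ` inc X r"
    then obtain x y where "p = (f x, f y)" "(x, y) \<in> inc X r" by auto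
    then show "p \<in> inc (f ` X) (map_prod f f ` r)" by (simp add: inc_def *)
  qed
qed

lemma strict_alternating_cycle_map:
  assumes f: "inj_on f X" and r: "r \<subseteq> X \<times> X" and S: "strict_alternating_cycle X r S"
  shows "strict_alternating_cycle (f ` X) (map_prod f f ` r) (map (map_prod f f) S)"
proof -
  have rel: "(f x, f y) \<in> map_prod f f ` r \<longleftrightarrow> (x, y) \<in> r" if "x \<in> X" "y \<in> X" for x y
    using f r that by (rule map_prod_image_iff)
  have ne: "S \<noteq> []" and inc: "set S \<subseteq> inc X r"
    using S unfolding strict_alternating_cycle_def alternating_cycle_def by auto
  have mem: "fst (S ! i) \<in> X" "snd (S ! i) \<in> X" if "i < length S" for i
    using inc nth_mem[OF that] unfolding inc_def by auto
  show ?thesis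
    unfolding strict_alternating_cycle_def alternating_cycle_def inc_map_prod[OF f r]
  proof (intro conjI allI impI)
    show "map (map_prod f f) S \<noteq> []" using ne by simp
    show "set (map (map_prod f f) S) \<subseteq> map_prod f f ` inc X r" using inc by auto
  next
    fix i assume i: "i < length (map (map_prod f f) S)"
    have j: "(i + 1) mod length S < length S" using ne by (intro mod_less_divisor) simp
    have "(snd (S ! i), fst (S ! ((i + 1) mod length S))) \<in> r"
      using S i unfolding strict_alternating_cycle_def alternating_cycle_def by simp
    then show "(snd (map (map_prod f f) S ! i),
        fst (map (map_prod f f) S ! ((i + 1) mod length (map (map_prod f f) S)))) \<in> map_prod f f ` r"
      unfolding length_map using i j mem by (simp only: length_map nth_map fst_map_prod snd_map_prod rel)
  next
    fix i j assume "i < length (map (map_prod f f) S)" "j < length (map (map_prod f f) S)"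
      "(snd (map (map_prod f f) S ! i), fst (map (map_prod f f) S ! j)) \<in> map_prod f f ` r"
    then have "i < length S" "j < length S" "(snd (S ! i), fst (S ! j)) \<in> r"
      using mem by (simp_all only: length_map nth_map fst_map_prod snd_map_prod rel)
    then show "j = (i + 1) mod length (map (map_prod f f) S)"
      using S unfolding strict_alternating_cycle_def by simp
  qed
qed

lemma card_ACs_map_le:
  assumes X: "finite X" and f: "inj_on f X" and r: "r \<subseteq> X \<times> X"
  shows "card (ACs X r) \<le> card (ACs (f ` X) (map_prod f f ` r))"
proof (rule card_inj_on_le)
  let ?g = "map (map_prod f f)"
  have cls: "?g ` (cyclic_shift_rel `` {S}) = cyclic_shift_rel `` {?g S}" for S
    by (auto simp: cyclic_shift_rel_def rotate_map image_iff)
  show "finite (ACs (f ` X) (map_prod f f ` r))" using X by (simp add: finite_ACs)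
  show "(`) ?g ` ACs X r \<subseteq> ACs (f ` X) (map_prod f f ` r)"
    unfolding ACs_conv_image using strict_alternating_cycle_map[OF f r] by (auto simp: cls)
  have "inj_on (map_prod f f) (X \<times> X)" using f by (rule map_prod_inj_on) (rule f)
  then have "inj_on ?g (lists (X \<times> X))" by (rule inj_on_map_lists)
  moreover have "C \<subseteq> lists (X \<times> X)" if "C \<in> ACs X r" for C
    using that strict_alternating_cycle_length(1)[OF X]
    unfolding ACs_conv_image by (force simp: cyclic_shift_rel_def in_lists_conv_set)
  ultimately show "inj_on ((`) ?g) (ACs X r)"
    by (intro inj_onI) (simp add: inj_on_image_eq_iff)
qed

lemma MACs_greatest:
  fixes X :: "'a set"
  assumes P: "finite_poset X r" and n: "card X \<le> n"
  shows "card (ACs X r) \<le> MACs n"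
proof -
  have X: "finite X" "X \<noteq> {}" "r \<subseteq> X \<times> X" and po: "refl_on X r" "trans r" "antisym r"
    using P unfolding finite_poset_def partial_order_on_def preorder_on_def by auto
  obtain f :: "'a \<Rightarrow> nat" where f: "inj_on f X"
    using X(1) finite_imp_inj_to_nat_seg by blast
  let ?r = "map_prod f f ` r"
  have inj: "x = y" if "f x = f y" "x \<in> X" "y \<in> X" for x y
    using f that by (auto simp: inj_on_def)
  have "trans ?r"
  proof (rule transI)
    fix u v w assume "(u, v) \<in> ?r" "(v, w) \<in> ?r"
    then obtain a b c d where *: "(a, b) \<in> r" "(c, d) \<in> r" "u = f a" "v = f b" "v = f c" "w = f d"
      by auto
    then have "b = c" using X(3) inj by blast
    then have "(a, d) \<in> r" using * po(2) by (blast dest: transD)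
    then show "(u, w) \<in> ?r" using * by force
  qed
  moreover have "antisym ?r"
  proof (rule antisymI)
    fix u v assume "(u, v) \<in> ?r" "(v, u) \<in> ?r"
    then obtain a b c d where *: "(a, b) \<in> r" "(c, d) \<in> r" "u = f a" "v = f b" "v = f c" "u = f d"
      by auto
    then have "b = c" "a = d" using X(3) inj by blast+
    then have "a = b" using * po(3) by (blast dest: antisymD)
    then show "u = v" using * by simp
  qed
  moreover have "refl_on (f ` X) ?r" using po(1) by (force simp: refl_on_def)
  moreover have "?r \<subseteq> f ` X \<times> f ` X" using X(3) by auto
  ultimately have "finite_poset (f ` X) ?r"
    using X by (simp add: finite_poset_def partial_order_on_def preorder_on_def)
  moreover have "card (f ` X) \<le> n" using n f by (simp add: card_image)
  ultimately have "card (ACs (f ` X) ?r) \<le> MACs n"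
    unfolding MACs_def by (intro Max_ge[OF finite_MACs_set]) blast
  with card_ACs_map_le[OF X(1) f X(3)] show ?thesis by linarith
qed

end

theory Submission
  imports Defs
begin

text \<open>In a strict alternating cycle \<open>[(x\<^sub>1, y\<^sub>1), \<dots>, (x\<^sub>k, y\<^sub>k)]\<close> the only relations from
  a \<open>y\<^sub>i\<close> to an \<open>x\<^sub>j\<close> are \<open>y\<^sub>i \<le> x\<^sub>i\<^sub>+\<^sub>1\<close>. The cycles of the trivial poset are those in which all
  these relations are equalities, so a cycle of an arbitrary poset becomes one of the trivial poset
  when the pair \<open>(y\<^sub>i, x\<^sub>i\<^sub>+\<^sub>1)\<close> is inserted after \<open>(x\<^sub>i, y\<^sub>i)\<close> wherever \<open>y\<^sub>i < x\<^sub>i\<^sub>+\<^sub>1\<close>. Strictness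
  ensures that no element is visited twice, which is all that strictness asks for in the trivial
  poset (\<open>strict_alternating_cycle_bridge\<close>).

  Nothing is lost by this insertion: the original pairs are incomparable and the inserted ones are
  comparable, so intersecting with the incomparable pairs recovers the original set of pairs.
  This set in turn determines a strict alternating cycle up to cyclic shift, since every pair
  has a unique successor in it (\<open>strict_alternating_cycle_set_eqD\<close>). Hence a poset has at most as many
  strict alternating cycles as the trivial poset on the same ground set
  (\<open>card_ACs_le_trivial\<close>), and among trivial posets a larger ground set gives at least as many cycles.\<close>

section \<open>Strict alternating cycles as sets of pairs\<close>

lemma strict_alternating_cycleD:
  assumes "strict_alternating_cycle X r S"
  shows "S \<noteq> []" "set S \<subseteq> inc X r"
    and "i < length S \<Longrightarrow> j < length S \<Longrightarrow>
      (snd (S ! i), fst (S ! j)) \<in> r \<longleftrightarrow> j = (i + 1) mod length S"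
  using assms unfolding strict_alternating_cycle_def alternating_cycle_def by auto

lemma strict_alternating_cycleI:
  assumes "S \<noteq> []" "set S \<subseteq> inc X r"
    and "\<And>i j. i < length S \<Longrightarrow> j < length S \<Longrightarrow>
      (snd (S ! i), fst (S ! j)) \<in> r \<longleftrightarrow> j = (i + 1) mod length S"
  shows "strict_alternating_cycle X r S"
  using assms unfolding strict_alternating_cycle_def alternating_cycle_def by simp

lemma Suc_mod_inject:
  assumes "i < k" "j < k" "(i + 1) mod k = (j + 1) mod k"
  shows "i = (j :: nat)"
  using assms by (auto simp: mod_Suc split: if_splits)

lemma strict_alternating_cycle_successor_unique:
  assumes S: "strict_alternating_cycle X r S"
    and "p \<in> set S" "q \<in> set S" "q' \<in> set S" "(snd p, fst q) \<in> r" "(snd p, fst q') \<in> r"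
  shows "q = q'"
proof -
  obtain i j j' where ij: "i < length S" "p = S ! i" "j < length S" "q = S ! j"
      "j' < length S" "q' = S ! j'"
    using assms(2-4) by (auto simp: in_set_conv_nth)
  have "j = (i + 1) mod length S" "j' = (i + 1) mod length S"
    using assms(5,6) strict_alternating_cycleD(3)[OF S] ij by blast+
  then show ?thesis using ij by simp
qed

lemma strict_alternating_cycle_predecessor_unique:
  assumes S: "strict_alternating_cycle X r S"
    and ij: "i < length S" "j < length S" and q: "q \<in> set S"
    and rel: "(snd (S ! i), fst q) \<in> r" "(snd (S ! j), fst q) \<in> r"
  shows "i = j"
proof -
  obtain l where l: "l < length S" "q = S ! l" using q by (auto simp: in_set_conv_nth)
  have "l = (i + 1) mod length S" "l = (j + 1) mod length S"
    using rel ij strict_alternating_cycleD(3)[OF S _ l(1)] unfolding l(2) by blast+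
  then show ?thesis using Suc_mod_inject[OF ij] by simp
qed

lemma strict_alternating_cycle_predecessor_exists:
  assumes S: "strict_alternating_cycle X r S" and q: "q \<in> set S"
  shows "\<exists>p \<in> set S. (snd p, fst q) \<in> r"
proof -
  obtain j where j: "j < length S" "q = S ! j" using q by (auto simp: in_set_conv_nth)
  let ?i = "if j = 0 then length S - 1 else j - 1"
  have "?i < length S" "(?i + 1) mod length S = j" using j by auto
  then have "(snd (S ! ?i), fst q) \<in> r"
    using strict_alternating_cycleD(3)[OF S, of ?i j] j by simp
  with \<open>?i < length S\<close> show ?thesis using nth_mem by blast
qed

lemma strict_alternating_cycle_distinct_snd:
  assumes S: "strict_alternating_cycle X r S"
  shows "distinct (map snd S)"
proof (subst distinct_conv_nth, intro allI impI notI)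
  fix i j
  assume ij: "i < length (map snd S)" "j < length (map snd S)" "i \<noteq> j"
    and eq: "map snd S ! i = map snd S ! j"
  let ?l = "(i + 1) mod length S"
  have l: "?l < length S" using ij by (intro mod_less_divisor) auto
  then have "(snd (S ! i), fst (S ! ?l)) \<in> r"
    using ij strict_alternating_cycleD(3)[OF S] by simp
  then show False
    using strict_alternating_cycle_predecessor_unique[OF S, of i j "S ! ?l"] ij eq l by simp
qed

text \<open>Each pair determines its successor, so two cycles on the same pairs traverse them in the
  same order from whichever pair they start with.\<close>

lemma strict_alternating_cycle_set_eqD:
  assumes S: "strict_alternating_cycle X r S" and T: "strict_alternating_cycle X r T"
    and eq: "set S = set T"
  shows "\<exists>m. T = rotate m S"
proof -
  have "distinct S" "distinct T"
    using S T by (auto dest: strict_alternating_cycle_distinct_snd simp: distinct_map)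
  then have len: "length T = length S" using eq by (simp flip: distinct_card)
  have pos: "0 < length S" using strict_alternating_cycleD(1)[OF S] by simp
  then have "T ! 0 \<in> set S" using len eq by simp
  then obtain m where m: "m < length S" "T ! 0 = S ! m" by (metis in_set_conv_nth)
  have nth: "T ! i = S ! ((m + i) mod length S)" if "i < length T" for i
    using that
  proof (induction i)
    case 0
    then show ?case using m by simp
  next
    case (Suc i)
    let ?j = "(m + i) mod length S"
    have j: "?j < length S" "(?j + 1) mod length S < length S" using pos by simp_all
    have IH: "T ! i = S ! ?j" using Suc by simp
    have "(snd (T ! i), fst (T ! Suc i)) \<in> r"
      using Suc.prems strict_alternating_cycleD(3)[OF T, of i "Suc i"] by simp
    moreover have "(snd (S ! ?j), fst (S ! ((?j + 1) mod length S))) \<in> r"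
      using strict_alternating_cycleD(3)[OF S j] by simp
    moreover have "T ! Suc i \<in> set S" unfolding eq using Suc.prems by (rule nth_mem)
    ultimately have "T ! Suc i = S ! ((?j + 1) mod length S)"
      using strict_alternating_cycle_successor_unique[OF S, of "S ! ?j"] j
      unfolding IH by (blast intro: nth_mem)
    then show ?case by (simp add: mod_simps)
  qed
  have "T = rotate m S"
    by (rule nth_equalityI) (simp_all add: len nth nth_rotate)
  then show ?thesis ..
qed

text \<open>Both images are in bijection with the quotient of \<open>A\<close> by the common kernel of
  \<open>f\<close> and \<open>g\<close>.\<close>

lemma card_image_cong_kernel:
  assumes "\<And>x y. x \<in> A \<Longrightarrow> y \<in> A \<Longrightarrow> f x = f y \<longleftrightarrow> g x = g y"
  shows "card (f ` A) = card (g ` A)"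
proof -
  let ?h = "\<lambda>u. g (inv_into A f u)"
  have h: "?h (f x) = g x" if x: "x \<in> A" for x
  proof -
    have "inv_into A f (f x) \<in> A" using x by (intro inv_into_into imageI)
    moreover have "f (inv_into A f (f x)) = f x" using x by (intro f_inv_into_f imageI)
    ultimately show ?thesis using assms[of "inv_into A f (f x)" x] x by simp
  qed
  have "inj_on ?h (f ` A)"
  proof (intro inj_onI; elim imageE)
    fix u v x y assume "?h u = ?h v" "u = f x" "v = f y" "x \<in> A" "y \<in> A"
    then show "u = v" using assms[of x y] h[of x] h[of y] by simp
  qed
  then have "card (?h ` f ` A) = card (f ` A)" by (rule card_image)
  also have "?h ` f ` A = g ` A" unfolding image_image using h by (intro image_cong) simp_all
  finally show ?thesis by simp
qed

lemma card_ACs_eq_card_sets: "card (ACs X r) = card (set ` {S. strict_alternating_cycle X r S})"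
  unfolding ACs_conv_image
proof (rule card_image_cong_kernel)
  fix S T
  assume ST: "S \<in> {S. strict_alternating_cycle X r S}" "T \<in> {S. strict_alternating_cycle X r S}"
  have "cyclic_shift_rel `` {S} = cyclic_shift_rel `` {T} \<longleftrightarrow> (S, T) \<in> cyclic_shift_rel"
    by (rule eq_equiv_class_iff[OF equiv_cyclic_shift_rel UNIV_I UNIV_I])
  also have "\<dots> \<longleftrightarrow> set S = set T"
    using ST strict_alternating_cycle_set_eqD by (fastforce simp: cyclic_shift_rel_def)
  finally show "cyclic_shift_rel `` {S} = cyclic_shift_rel `` {T} \<longleftrightarrow> set S = set T" .
qed

section \<open>Cycles of the trivial poset\<close>

lemma finite_poset_Id_on: "finite X \<Longrightarrow> X \<noteq> {} \<Longrightarrow> finite_poset X (Id_on X)"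
  by (auto simp: finite_poset_def partial_order_on_def preorder_on_def refl_on_def trans_def
      antisym_def)

lemma inc_Id_on: "inc X (Id_on X) = {(x, y). x \<in> X \<and> y \<in> X \<and> x \<noteq> y}"
  by (auto simp: inc_def)

lemma strict_alternating_cycle_Id_on_mono:
  assumes "strict_alternating_cycle Y (Id_on Y) S" "Y \<subseteq> X"
  shows "strict_alternating_cycle X (Id_on X) S"
proof -
  have sub: "set S \<subseteq> Y \<times> Y" using strict_alternating_cycleD(2)[OF assms(1)] by (auto simp: inc_def)
  have "(snd (S ! i), fst (S ! j)) \<in> Id_on X \<longleftrightarrow> j = (i + 1) mod length S"
    if "i < length S" "j < length S" for i j
  proof -
    have "snd (S ! i) \<in> Y" using nth_mem[OF that(1)] sub by auto
    then have "(snd (S ! i), fst (S ! j)) \<in> Id_on X \<longleftrightarrow> (snd (S ! i), fst (S ! j)) \<in> Id_on Y"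
      using assms(2) by (auto simp: Id_on_iff)
    also have "\<dots> \<longleftrightarrow> j = (i + 1) mod length S"
      by (rule strict_alternating_cycleD(3)[OF assms(1) that])
    finally show ?thesis .
  qed
  moreover have "set S \<subseteq> inc X (Id_on X)"
    using strict_alternating_cycleD(2)[OF assms(1)] assms(2) by (auto simp: inc_Id_on)
  ultimately show ?thesis
    using strict_alternating_cycleD(1)[OF assms(1)] by (intro strict_alternating_cycleI)
qed

text \<open>An injection of \<open>Y\<close> into \<open>X\<close> identifies the trivial poset on \<open>Y\<close> with the trivial poset
  on a subset of \<open>X\<close>, and enlarging the ground set destroys no cycle.\<close>

lemma card_ACs_Id_on_mono:
  assumes X: "finite X" and Y: "finite Y" "card Y \<le> card X"
  shows "card (ACs Y (Id_on Y)) \<le> card (ACs X (Id_on X))"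
proof -
  obtain f where f: "f ` Y \<subseteq> X" "inj_on f Y"
    using card_le_inj[OF Y(1) X Y(2)] by (elim exE conjE)
  have "card (ACs Y (Id_on Y)) \<le> card (ACs (f ` Y) (map_prod f f ` Id_on Y))"
    by (rule card_ACs_map_le) (use f Y in auto)
  also have "map_prod f f ` Id_on Y = Id_on (f ` Y)" unfolding Id_on_def by auto
  also have "card (ACs (f ` Y) (Id_on (f ` Y))) \<le> card (ACs X (Id_on X))"
    unfolding card_ACs_eq_card_sets
  proof (rule card_mono)
    show "finite (set ` {S. strict_alternating_cycle X (Id_on X) S})"
      using X by (intro finite_imageI finite_strict_alternating_cycles)
    show "set ` {S. strict_alternating_cycle (f ` Y) (Id_on (f ` Y)) S} \<subseteq>
        set ` {S. strict_alternating_cycle X (Id_on X) S}"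
      by (intro image_mono Collect_mono impI) (rule strict_alternating_cycle_Id_on_mono[OF _ f(1)])
  qed
  finally show ?thesis .
qed

lemma successively_snoc_hd_conv_nth:
  assumes "S \<noteq> []"
  shows "successively R (S @ [hd S]) \<longleftrightarrow>
    (\<forall>i < length S. R (S ! i) (S ! ((i + 1) mod length S)))"
proof -
  have "(S @ [hd S]) ! Suc i = S ! ((i + 1) mod length S)" if "i < length S" for i
  proof (cases "Suc i = length S")
    case True
    then have "(S @ [hd S]) ! Suc i = hd S" by (metis nth_append_length)
    then show ?thesis using True assms by (simp add: hd_conv_nth)
  next
    case False
    then show ?thesis using that by (simp add: nth_append)
  qed
  then show ?thesis
    unfolding successively_conv_nth by (simp add: nth_append)
qed

text \<open>With equality as the order, an element \<open>y\<close> has at most one first entry above it as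
  soon as the first entries are distinct, so strictness reduces to distinctness.\<close>

lemma strict_alternating_cycle_Id_onI:
  assumes ne: "S \<noteq> []" and sub: "set S \<subseteq> inc X (Id_on X)" and dist: "distinct (map fst S)"
    and chain: "successively (\<lambda>p q. snd p = fst q) (S @ [hd S])"
  shows "strict_alternating_cycle X (Id_on X) S"
proof -
  have next_eq: "snd (S ! i) = fst (S ! ((i + 1) mod length S))" if "i < length S" for i
    using chain that unfolding successively_snoc_hd_conv_nth[OF ne] by blast
  have less: "(i + 1) mod length S < length S" for i using ne by simp
  have mem: "snd (S ! i) \<in> X" if "i < length S" for i
    using nth_mem[OF that] sub by (auto simp: inc_def)
  have "(snd (S ! i), fst (S ! j)) \<in> Id_on X \<longleftrightarrow> j = (i + 1) mod length S"
    if "i < length S" "j < length S" for i j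
  proof -
    have "(snd (S ! i), fst (S ! j)) \<in> Id_on X \<longleftrightarrow> fst (S ! ((i + 1) mod length S)) = fst (S ! j)"
      unfolding Id_on_iff next_eq[OF that(1), symmetric] using mem[OF that(1)] by blast
    also have "\<dots> \<longleftrightarrow> j = (i + 1) mod length S"
      using nth_eq_iff_index_eq[OF dist, of "(i + 1) mod length S" j] less[of i] that(2)
      by (simp only: length_map nth_map eq_commute)
    finally show ?thesis .
  qed
  then show ?thesis using ne sub by (intro strict_alternating_cycleI)
qed

section \<open>Bridging the gaps of a cycle\<close>

text \<open>The last entry only says where the final gap leads to and is dropped, so that a cycle
  \<open>S\<close> is closed up by bridging \<open>S @ [hd S]\<close>.\<close>

fun bridge :: "('a \<times> 'a) list \<Rightarrow> ('a \<times> 'a) list" where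
  "bridge (p # q # L) =
     p # (if snd p = fst q then [] else [(snd p, fst q)]) @ bridge (q # L)"
| "bridge _ = []"

lemma successively_bridge:
  "L \<noteq> [] \<Longrightarrow> successively (\<lambda>p q. snd p = fst q) (bridge L @ [last L]) \<and>
     hd (bridge L @ [last L]) = hd L"
  by (induction L rule: bridge.induct) (auto simp: successively_Cons)

lemma set_butlast_subset_bridge: "set (butlast L) \<subseteq> set (bridge L)"
  by (induction L rule: bridge.induct) auto

lemma set_bridge_cases:
  assumes "successively R L" "u \<in> set (bridge L)"
  obtains "u \<in> set (butlast L)"
  | p q where "p \<in> set (butlast L)" "q \<in> set L" "R p q" "snd p \<noteq> fst q" "u = (snd p, fst q)"
proof -
  have "u \<in> set (butlast L) \<or> (\<exists>p \<in> set (butlast L). \<exists>q \<in> set L.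
      R p q \<and> snd p \<noteq> fst q \<and> u = (snd p, fst q))"
    using assms
  proof (induction L rule: bridge.induct)
    case (1 p q L)
    have chain: "R p q" "successively R (q # L)" using "1.prems"(1) by simp_all
    consider "u = p" | "snd p \<noteq> fst q" "u = (snd p, fst q)" | "u \<in> set (bridge (q # L))"
      using "1.prems"(2) by (auto split: if_splits)
    then show ?case
    proof cases
      case 1
      then show ?thesis by simp
    next
      case 2
      then show ?thesis using chain(1) by simp
    next
      case 3
      have sets: "set (butlast (p # q # L)) = insert p (set (butlast (q # L)))"
          "set (p # q # L) = insert p (set (q # L))"
        by simp_all
      from "1.IH"[OF chain(2) 3] show ?thesis unfolding sets by blast
    qed
  qed simp_all
  then show thesis using that by blast
qed

text \<open>Inserted pairs lie in \<open>r\<close> and so differ from the original ones; they differ from each other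
  because their first entries are second entries of different pairs.\<close>

lemma distinct_bridge:
  assumes "successively (\<lambda>p q. (snd p, fst q) \<in> r) L" "set (butlast L) \<inter> r = {}"
    "distinct (map snd (butlast L))"
  shows "distinct (bridge L)"
  using assms
proof (induction L rule: bridge.induct)
  case (1 p q L)
  let ?B = "butlast (q # L)"
  have chain: "successively (\<lambda>p q. (snd p, fst q) \<in> r) (q # L)" and rel: "(snd p, fst q) \<in> r"
    using "1.prems"(1) by simp_all
  have B: "p \<notin> r" "set ?B \<inter> r = {}" "snd p \<notin> snd ` set ?B" "distinct (map snd ?B)"
    using "1.prems"(2,3) by simp_all
  have "distinct (bridge (q # L))" using chain B by (intro "1.IH")
  moreover have "p \<notin> set (bridge (q # L))"
  proof
    assume "p \<in> set (bridge (q # L))"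
    with chain show False by (cases rule: set_bridge_cases) (use B in auto)
  qed
  moreover have "(snd p, fst q) \<notin> set (bridge (q # L))"
  proof
    assume "(snd p, fst q) \<in> set (bridge (q # L))"
    with chain show False
    proof (cases rule: set_bridge_cases)
      case 1
      then show False using B(2) rel by blast
    next
      case (2 p' q')
      then show False using B(3) by (auto simp: image_iff)
    qed
  qed
  ultimately show ?case using B(1) rel by auto
qed auto

text \<open>The point is that no element occurs twice as a first entry of \<open>T\<close>. An element \<open>y\<^sub>i\<close> that
  heads an inserted pair is not some \<open>x\<^sub>j\<close>: reflexivity would give \<open>y\<^sub>i \<le> x\<^sub>j\<close>, so \<open>j = i + 1\<close> by
  strictness, whereas \<open>y\<^sub>i = x\<^sub>i\<^sub>+\<^sub>1\<close> leaves no gap to insert a pair into.\<close>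

lemma strict_alternating_cycle_bridge:
  assumes P: "finite_poset X r" and S: "strict_alternating_cycle X r S"
  defines "T \<equiv> bridge (S @ [hd S])"
  shows "strict_alternating_cycle X (Id_on X) T" and "set T \<inter> inc X r = set S"
proof -
  have refl: "(x, x) \<in> r" if "x \<in> X" for x
    using P that by (auto simp: finite_poset_def partial_order_on_def preorder_on_def refl_on_def)
  note ne = strict_alternating_cycleD(1)[OF S] and sub = strict_alternating_cycleD(2)[OF S]
  have mem: "fst p \<in> X" "snd p \<in> X" "fst p \<noteq> snd p" "p \<notin> r" if "p \<in> set S" for p
    using that sub refl by (auto simp: inc_def)
  have chain: "successively (\<lambda>p q. (snd p, fst q) \<in> r) (S @ [hd S])"
    unfolding successively_snoc_hd_conv_nth[OF ne]
  proof (intro allI impI)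
    fix i assume "i < length S"
    then show "(snd (S ! i), fst (S ! ((i + 1) mod length S))) \<in> r"
      using strict_alternating_cycleD(3)[OF S, of i "(i + 1) mod length S"] ne by simp
  qed
  have cases: "u \<in> set S \<or> (\<exists>p \<in> set S. \<exists>q \<in> set S.
      (snd p, fst q) \<in> r \<and> snd p \<noteq> fst q \<and> u = (snd p, fst q))" if "u \<in> set T" for u
  proof -
    have closed: "set (S @ [hd S]) = set S" using ne by auto
    from chain that[unfolded T_def] show ?thesis
      by (cases rule: set_bridge_cases) (unfold closed butlast_snoc, blast+)
  qed
  have S_sub: "set S \<subseteq> set T"
    unfolding T_def using set_butlast_subset_bridge[of "S @ [hd S]"] by simp
  show "set T \<inter> inc X r = set S"
    using cases S_sub sub by (fastforce simp: inc_def)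
  have fst_inj: "p = p'" if p: "p \<in> set S" "p' \<in> set S" "fst p = fst p'" for p p'
  proof -
    obtain p0 where "p0 \<in> set S" "(snd p0, fst p) \<in> r"
      using strict_alternating_cycle_predecessor_exists[OF S p(1)] by blast
    then show ?thesis
      using strict_alternating_cycle_successor_unique[OF S, of p0 p p'] p by simp
  qed
  have no_gap: "snd p \<noteq> fst q'" if "p \<in> set S" "q \<in> set S" "(snd p, fst q) \<in> r" "snd p \<noteq> fst q"
      "q' \<in> set S" for p q q'
    using strict_alternating_cycle_successor_unique[OF S that(1,2,5,3)] that mem(2) refl by metis
  have gaps: "fst q = fst q'" if "p \<in> set S" "q \<in> set S" "q' \<in> set S" "(snd p, fst q) \<in> r"
      "(snd p', fst q') \<in> r" "snd p = snd p'" for p p' q q'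
    using strict_alternating_cycle_successor_unique[OF S that(1-4)] that by simp
  have "inj_on fst (set T)"
  proof (rule inj_onI)
    fix u v assume uv: "u \<in> set T" "v \<in> set T" "fst u = fst v"
    show "u = v"
      using cases[OF uv(1)] cases[OF uv(2)]
    proof (elim disjE bexE conjE)
      assume "u \<in> set S" "v \<in> set S"
      then show ?thesis using fst_inj uv(3) by blast
    next
      fix p q assume pq: "v \<in> set S" "p \<in> set S" "q \<in> set S" "(snd p, fst q) \<in> r" "snd p \<noteq> fst q"
        "u = (snd p, fst q)"
      then show ?thesis using no_gap[OF pq(2-5,1)] uv(3) by simp
    next
      fix p q assume pq: "u \<in> set S" "p \<in> set S" "q \<in> set S" "(snd p, fst q) \<in> r" "snd p \<noteq> fst q"
        "v = (snd p, fst q)"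
      then show ?thesis using no_gap[OF pq(2-5,1)] uv(3) by simp
    next
      fix p q p' q' assume "p \<in> set S" "q \<in> set S" "(snd p, fst q) \<in> r" "u = (snd p, fst q)"
        "p' \<in> set S" "q' \<in> set S" "(snd p', fst q') \<in> r" "v = (snd p', fst q')"
      then show ?thesis using gaps[of p q q' p'] uv(3) by simp
    qed
  qed
  moreover have "distinct T"
    unfolding T_def
    by (rule distinct_bridge[OF chain])
      (use mem strict_alternating_cycle_distinct_snd[OF S] in auto)
  ultimately have "distinct (map fst T)" by (simp add: distinct_map)
  moreover have "T \<noteq> []" using S_sub ne by auto
  moreover have "set T \<subseteq> inc X (Id_on X)"
  proof
    fix u assume "u \<in> set T"
    from cases[OF this] have "fst u \<in> X \<and> snd u \<in> X \<and> fst u \<noteq> snd u"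
      using mem by (elim disjE bexE conjE) simp_all
    then show "u \<in> inc X (Id_on X)" by (cases u) (simp add: inc_Id_on)
  qed
  moreover have "successively (\<lambda>p q. snd p = fst q) (T @ [hd T])"
    using successively_bridge[of "S @ [hd S]"] \<open>T \<noteq> []\<close> ne by (simp add: T_def)
  ultimately show "strict_alternating_cycle X (Id_on X) T"
    by (intro strict_alternating_cycle_Id_onI)
qed

text \<open>Restricting to incomparable pairs undoes the insertion, hence maps the cycles of the trivial
  poset, as sets of pairs, onto a family containing those of \<open>r\<close>.\<close>

lemma card_ACs_le_trivial:
  assumes P: "finite_poset X r"
  shows "card (ACs X r) \<le> card (ACs X (Id_on X))"
  unfolding card_ACs_eq_card_sets
proof (rule surj_card_le[where f = "\<lambda>A. A \<inter> inc X r"])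
  show "finite (set ` {S. strict_alternating_cycle X (Id_on X) S})"
    using P by (simp add: finite_poset_def finite_strict_alternating_cycles)
  show "set ` {S. strict_alternating_cycle X r S} \<subseteq>
      (\<lambda>A. A \<inter> inc X r) ` set ` {S. strict_alternating_cycle X (Id_on X) S}"
  proof
    fix A assume "A \<in> set ` {S. strict_alternating_cycle X r S}"
    then obtain S where S: "A = set S" "strict_alternating_cycle X r S" by blast
    show "A \<in> (\<lambda>A. A \<inter> inc X r) ` set ` {S. strict_alternating_cycle X (Id_on X) S}"
      using strict_alternating_cycle_bridge[OF P S(2)] unfolding S(1) by blast
  qed
qed

theorem proposition4p4:
  fixes n :: nat and X :: "'a set"
  assumes "n > 0" and "finite X" and "card X = n"
  shows "MACs n = card (ACs X (Id_on X))"
proof (rule antisym)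
  obtain Y :: "nat set" and r where Y: "finite_poset Y r" "card Y \<le> n" "MACs n = card (ACs Y r)"
    using MACs_attained[OF assms(1)] by blast
  have "MACs n \<le> card (ACs Y (Id_on Y))" using card_ACs_le_trivial[OF Y(1)] Y(3) by simp
  also have "\<dots> \<le> card (ACs X (Id_on X))"
    by (rule card_ACs_Id_on_mono) (use assms Y in \<open>auto simp: finite_poset_def\<close>)
  finally show "MACs n \<le> card (ACs X (Id_on X))" .
  show "card (ACs X (Id_on X)) \<le> MACs n"
    using assms by (intro MACs_greatest finite_poset_Id_on) auto
qed

end
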